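(* The mapping $\Phi\mapsto\mathcal{Q}\Phi(x-1)$ establishes an isomorphism between the ring of unital endomorphisms of $F_0(n)$ with respect to composition of maps and $\mathcal{Q}F_0(n)$, equipped with composition of polynomials in the variable $(x-1)$. Under this identification, a polynomial $P=1+P_0\in F_0(n)$ corresponds to an automorphism $\Phi$ of $F_0(n)$ if and only if there is a polynomial $Q=1+Q_0\in F_0(n)$ such that $P_0\circ Q_0=Q_0\circ P_0=(x-1)$, which is equivalent to $\mathcal{Q}\Phi(x-1)=(x-1)+\sum_{k=2}^{n-1}\varepsilon_k(x-1)^k$ (with $\varepsilon_k\in\mathbb{F}_2$).
   Context: For a natural number $n$, $F_0(n)=\{1+\sum_{i=1}^{n-1}\varepsilon_i(x-1)^i:\varepsilon_i\in\mathbb{F}_2\}$, where $(x-1)^n=0$; it is a unital 3-field with the multiplication and the ternary addition $(a,b,c)\mapsto a+b+c$ inherited from $\mathbb{F}_2[x]/((x-1)^n)$. Further, $\mathcal{Q}F_0(n)=\{\sum_{i=1}^{n-1}\varepsilon_i(x-1)^i:\varepsilon_i\in\mathbb{F}_2\}$, a non-unital binary ring consisting of the sums $f+g$ with $f,g\in F_0(n)$. A unital endomorphism $\Phi$ of $F_0(n)$ is a map $F_0(n)\to F_0(n)$ preserving ternary addition, multiplication and $1$; it induces the ring endomorphism $\mathcal{Q}\Phi$ of $\mathcal{Q}F_0(n)$ given by $\mathcal{Q}\Phi(f+g)=\Phi(f)+\Phi(g)$ for $f,g\in F_0(n)$. An automorphism is a bijective endomorphism. For $P_0,Q_0\in\mathcal{Q}F_0(n)$,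 regarded as polynomials in the variable $(x-1)$, $Q_0\circ P_0$ denotes the result of substituting $P_0$ for $(x-1)$ in $Q_0$, modulo $(x-1)^n$. The polynomial $P=1+P_0\in F_0(n)$ corresponds to the unital endomorphism $\Phi_P$ with $\Phi_P(1+Q_0)=1+Q_0\circ P_0$, so that $\mathcal{Q}\Phi_P(x-1)=P_0$.
   Formalization: The mapping reverses the order of composition, so the isomorphism is onto QF_0(n) with composition in the opposite order (as written it fails, e.g. n=5); "ring" is read as monoid under composition, since pointwise sums of endomorphisms need not be endomorphisms; n is at least 1. *)

theory Defs
  imports
    "HOL-Computational_Algebra.Polynomial"
    "HOL-Library.Z2"
    "HOL-Algebra.Group"
begin

text \<open>
  The ring of polynomials in $x$ over $F_2$ modulo $(x-1)^n$ is represented by the reduced residues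
  (polynomials of degree less than \<open>n\<close>, for \<open>n \<ge> 1\<close>). Sums of reduced residues are reduced, so
  only products and substitutions need an explicit reduction.
\<close>

definition modulus :: "nat \<Rightarrow> bit poly" where
  "modulus n = [:-1, 1:] ^ n"

text \<open>The residue class of $x - 1$; it is \<open>0\<close> for \<open>n = 1\<close>.\<close>

definition xm1 :: "nat \<Rightarrow> bit poly" where
  "xm1 n = [:-1, 1:] mod modulus n"

definition qmult :: "nat \<Rightarrow> bit poly \<Rightarrow> bit poly \<Rightarrow> bit poly" where
  "qmult n f g = (f * g) mod modulus n"

definition F0 :: "nat \<Rightarrow> bit poly set" where
  "F0 n = {1 + (\<Sum>i = 1..n - 1. smult (\<epsilon> i) ([:-1, 1:] ^ i)) | \<epsilon>. True}"

definition QF0 :: "nat \<Rightarrow> bit poly set" where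
  "QF0 n = {\<Sum>i = 1..n - 1. smult (\<epsilon> i) ([:-1, 1:] ^ i) | \<epsilon>. True}"

text \<open>
  \<open>qcomp n Q P\<close> is $Q \circ P$, the result of substituting \<open>P\<close> for $x - 1$ in \<open>Q\<close>. The inner
  \<open>pcompose\<close> rewrites \<open>Q\<close> as a polynomial in $y = x - 1$ (that is, $x = 1 + y$), the outer one
  substitutes \<open>P\<close> for $y$.
\<close>

definition qcomp :: "nat \<Rightarrow> bit poly \<Rightarrow> bit poly \<Rightarrow> bit poly" where
  "qcomp n Q P = pcompose (pcompose Q [:1, 1:]) P mod modulus n"

definition unital_endos :: "nat \<Rightarrow> (bit poly \<Rightarrow> bit poly) set" where
  "unital_endos n = {\<Phi> \<in> F0 n \<rightarrow>\<^sub>E F0 n.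
     (\<forall>f \<in> F0 n. \<forall>g \<in> F0 n. \<forall>h \<in> F0 n. \<Phi> (f + g + h) = \<Phi> f + \<Phi> g + \<Phi> h) \<and>
     (\<forall>f \<in> F0 n. \<forall>g \<in> F0 n. \<Phi> (qmult n f g) = qmult n (\<Phi> f) (\<Phi> g)) \<and>
     \<Phi> 1 = 1}"

definition unital_autos :: "nat \<Rightarrow> (bit poly \<Rightarrow> bit poly) set" where
  "unital_autos n = {\<Phi> \<in> unital_endos n. bij_betw \<Phi> (F0 n) (F0 n)}"

text \<open>
  The induced map \<open>Q\<Phi>\<close>, characterised by \<open>Q\<Phi> (f + g) = \<Phi> f + \<Phi> g\<close>; the description is proper
  because \<open>\<Phi> f + \<Phi> g\<close> depends only on \<open>f + g\<close> when \<open>\<Phi>\<close> preserves ternary sums.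
\<close>

definition Qmap :: "nat \<Rightarrow> (bit poly \<Rightarrow> bit poly) \<Rightarrow> bit poly \<Rightarrow> bit poly" where
  "Qmap n \<Phi> = (\<lambda>q \<in> QF0 n. THE r. \<exists>f \<in> F0 n. \<exists>g \<in> F0 n. q = f + g \<and> r = \<Phi> f + \<Phi> g)"

definition endo_monoid :: "nat \<Rightarrow> (bit poly \<Rightarrow> bit poly) monoid" where
  "endo_monoid n =
     \<lparr>carrier = unital_endos n, mult = (\<lambda>\<Phi> \<Psi>. compose (F0 n) \<Phi> \<Psi>), one = (\<lambda>f \<in> F0 n. f)\<rparr>"

definition QF0_monoid :: "nat \<Rightarrow> bit poly monoid" where
  "QF0_monoid n = \<lparr>carrier = QF0 n, mult = qcomp n, one = xm1 n\<rparr>"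

text \<open>
  Evaluation at $x - 1$ reverses the order of composition: since \<open>Q\<Phi> (R) = R \<circ> Q\<Phi> (x - 1)\<close>, one has
  \<open>Q(\<Phi> \<circ> \<Psi>) (x - 1) = Q\<Psi> (x - 1) \<circ> Q\<Phi> (x - 1)\<close>. With both compositions read in the usual order,
  the isomorphism is therefore onto the opposite monoid.
\<close>

definition opposite_monoid :: "'a monoid \<Rightarrow> 'a monoid" where
  "opposite_monoid G = \<lparr>carrier = carrier G, mult = (\<lambda>a b. b \<otimes>\<^bsub>G\<^esub> a), one = \<one>\<^bsub>G\<^esub>\<rparr>"

end

theory Submission
  imports Defs
begin

text \<open>
  Write \<open>Y = x - 1\<close>. A unital endomorphism \<open>\<Phi>\<close> of \<open>F0 n\<close> satisfies \<open>\<Phi> (1 + q) = 1 + \<psi> q\<close>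
  for a ring endomorphism \<open>\<psi>\<close> of \<open>QF0 n\<close>, and since every element of \<open>QF0 n\<close> is a polynomial
  in \<open>Y\<close> without constant term, \<open>\<psi> q\<close> is \<open>q\<close> with \<open>\<psi> Y\<close> substituted for \<open>Y\<close>.
  Automorphisms are the invertible elements of this substitution monoid. If \<open>Y\<^sup>2\<close> divides \<open>P\<close>, then
  it divides everything obtained by substituting \<open>P\<close>, so \<open>Y\<close> is not reached. Otherwise
  substitution of \<open>P\<close> preserves the \<open>Y\<close>-adic order; hence it is injective on the finite set
  \<open>QF0 n\<close>, and therefore bijective.
\<close>

section \<open>Arithmetic of polynomials over F_2 and the element \<open>Y\<close>\<close>

definition Y :: "bit poly" where
  "Y = [:-1, 1:]"

lemma Y_eq: "Y = [:1, 1:]"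
  by (simp add: Y_def)

lemma degree_Y [simp]: "degree Y = 1"
  by (simp add: Y_def)

lemma Y_nonzero [simp]: "Y \<noteq> 0"
  by (simp add: Y_def)

lemma poly_Y [simp]: "poly Y 1 = 0"
  by (simp add: Y_def)

lemma poly_Y_0 [simp]: "poly Y 0 = 1"
  by (simp add: Y_eq)

lemma Y_dvd_iff: "Y dvd p \<longleftrightarrow> poly p 1 = 0"
  by (simp add: Y_def poly_eq_0_iff_dvd)

lemma bit_poly_add_self [simp]: "p + p = (0 :: bit poly)"
  by (rule poly_eqI) (metis add_bit_eq_xor bit_numeral_rec(1) coeff_0 coeff_add xor_self_eq)

lemma bit_poly_numeral [simp]:
  "(numeral (Num.Bit0 k) :: bit poly) = 0"
  "(numeral (Num.Bit1 k) :: bit poly) = 1"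
  by (simp_all add: numeral_Bit0 numeral_Bit1)

lemma bit_poly_add_cancel [simp]: "p + (p + q) = (q :: bit poly)"
  by (metis add.assoc add_0 bit_poly_add_self)

text \<open>As a simp rule it removes subtraction, so congruences turn into divisibility of
  sums.\<close>

lemma bit_poly_diff [simp]: "p - q = (p + q :: bit poly)"
  by (metis add_diff_cancel add.assoc add_0_right bit_poly_add_self)

lemma bit_poly_add_eq_iff: "p + q = r \<longleftrightarrow> p = (q + r :: bit poly)"
  by (metis add.commute bit_poly_add_cancel)

lemma degree_modulus [simp]: "degree (modulus n) = n"
  by (simp add: modulus_def degree_power_eq)

lemma modulus_Y: "modulus n = Y ^ n"
  by (simp add: modulus_def Y_def)

lemma modulus_nonzero [simp]: "modulus n \<noteq> 0"
  by (simp add: modulus_Y)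

lemma xm1_Y: "xm1 n = Y mod modulus n"
  by (simp add: xm1_def Y_def)

lemma Y_dvd_modulus: "n \<ge> 1 \<Longrightarrow> Y dvd modulus n"
  by (simp add: modulus_Y dvd_power)

lemma degree_mod_modulus: "n \<ge> 1 \<Longrightarrow> degree (p mod modulus n) < n"
  by (metis degree_0 degree_mod_less' degree_modulus less_le_trans modulus_nonzero
      zero_less_one)

lemma mod_modulus_id: "degree p < n \<Longrightarrow> p mod modulus n = p"
  by (simp add: mod_poly_less)

section \<open>Expansion in powers of \<open>Y\<close>; the sets \<open>QF0 n\<close> and
  \<open>F0 n\<close>\<close>

lemma pcompose_sum_coeff: "pcompose p q = (\<Sum>i\<le>degree p. smult (coeff p i) (q ^ i))"
  by (simp add: pcompose_altdef poly_altdef degree_map_poly coeff_map_poly)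

lemma QF0_expand:
  assumes "degree p < n" "Y dvd p"
  shows "p = (\<Sum>i = 1..n - 1. smult (coeff (pcompose p Y) i) (Y ^ i))"
proof -
  let ?a = "pcompose p Y"
  \<comment> \<open>In characteristic 2 the substitution of x + 1 for x is an involution, so the
    coefficients of \<open>?a\<close> are those of \<open>p\<close> in powers of
    \<open>Y\<close>.\<close>
  have "p = pcompose ?a Y"
    by (simp add: Y_eq pcompose_pCons flip: pcompose_assoc)
  also have "\<dots> = (\<Sum>i\<le>degree ?a. smult (coeff ?a i) (Y ^ i))"
    by (rule pcompose_sum_coeff)
  also have "\<dots> = (\<Sum>i = 1..n - 1. smult (coeff ?a i) (Y ^ i))"
  proof (rule sum.mono_neutral_cong)
    have "degree ?a < n" using assms by (simp add: degree_pcompose)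
    then show "smult (coeff ?a i) (Y ^ i) = 0" if "i \<in> {..degree ?a} - {1..n - 1}" for i
    proof -
      have "i = 0" using that \<open>degree ?a < n\<close> by auto
      moreover have "coeff ?a 0 = poly ?a 0" by (simp add: poly_0_coeff_0)
      moreover have "\<dots> = 0" using assms(2) by (simp add: poly_pcompose Y_dvd_iff)
      ultimately show ?thesis by simp
    qed
    show "smult (coeff ?a i) (Y ^ i) = 0" if "i \<in> {1..n - 1} - {..degree ?a}" for i
      using that by (simp add: coeff_eq_0)
  qed auto
  finally show ?thesis .
qed

lemma Y_power_sum:
  assumes "m \<ge> 1" "n \<ge> 1"
  shows "degree (\<Sum>i = m..n - 1. smult (\<epsilon> i) (Y ^ i)) < n"
    and "Y ^ m dvd (\<Sum>i = m..n - 1. smult (\<epsilon> i) (Y ^ i))"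
proof -
  have "degree (\<Sum>i = m..n - 1. smult (\<epsilon> i) (Y ^ i)) \<le> n - 1"
    by (rule degree_sum_le)
      (auto intro!: order.trans[OF degree_smult_le] simp: degree_power_eq)
  then show "degree (\<Sum>i = m..n - 1. smult (\<epsilon> i) (Y ^ i)) < n"
    using assms by linarith
  show "Y ^ m dvd (\<Sum>i = m..n - 1. smult (\<epsilon> i) (Y ^ i))"
    by (rule dvd_sum) (auto intro: dvd_smult le_imp_power_dvd)
qed

text \<open>Trades coefficient families for degree and divisibility, which pass easily to sums and
  residues. For \<open>n = 0\<close> it fails: \<open>QF0 0\<close> is \<open>{0}\<close>, but no
  degree is below \<open>0\<close>.\<close>

lemma QF0_iff:
  assumes "n \<ge> 1"
  shows "p \<in> QF0 n \<longleftrightarrow> degree p < n \<and> Y dvd p"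
proof
  assume "p \<in> QF0 n"
  then show "degree p < n \<and> Y dvd p"
    using Y_power_sum[of 1 n] assms unfolding QF0_def Y_def[symmetric] by auto
next
  assume "degree p < n \<and> Y dvd p"
  then show "p \<in> QF0 n"
    using QF0_expand unfolding QF0_def Y_def[symmetric] by blast
qed

lemma F0_iff: "f \<in> F0 n \<longleftrightarrow> 1 + f \<in> QF0 n"
proof -
  have "F0 n = (+) 1 ` QF0 n"
    unfolding F0_def QF0_def by blast
  then show ?thesis
    by (metis (no_types, lifting) bit_poly_add_cancel imageE image_eqI)
qed

lemma Y_dvd_of_QF0: "p \<in> QF0 n \<Longrightarrow> Y dvd p"
  unfolding QF0_def Y_def[symmetric] by (auto intro!: dvd_sum dvd_smult)

text \<open>Only the values of \<epsilon> on \<open>{1..n - 1}\<close> matter. Finiteness later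
  turns injectivity into bijectivity.\<close>

lemma finite_QF0: "finite (QF0 n)"
proof -
  have "QF0 n \<subseteq> (\<lambda>\<epsilon>. \<Sum>i = 1..n - 1. smult (\<epsilon> i) ([:-1, 1:] ^ i)) ` ({1..n - 1} \<rightarrow>\<^sub>E UNIV)"
  proof
    fix p assume "p \<in> QF0 n"
    then obtain \<epsilon> :: "nat \<Rightarrow> bit" where \<epsilon>: "p = (\<Sum>i = 1..n - 1. smult (\<epsilon> i) ([:-1, 1:] ^ i))"
      unfolding QF0_def by blast
    show "p \<in> (\<lambda>\<epsilon>. \<Sum>i = 1..n - 1. smult (\<epsilon> i) ([:-1, 1:] ^ i)) ` ({1..n - 1} \<rightarrow>\<^sub>E UNIV)"
      by (rule image_eqI[of _ _ "restrict \<epsilon> {1..n - 1}"]) (auto simp: \<epsilon> intro!: sum.cong)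
  qed
  moreover have "finite (UNIV :: bit set)"
  proof (rule finite_subset)
    show "(UNIV :: bit set) \<subseteq> {0, 1}" by (auto intro: bit_not_one_iff[THEN iffD1])
  qed simp
  ultimately show ?thesis
    by (meson finite_PiE finite_atLeastAtMost finite_imageI finite_subset)
qed

lemma QF0_add: "n \<ge> 1 \<Longrightarrow> p \<in> QF0 n \<Longrightarrow> q \<in> QF0 n \<Longrightarrow> p + q \<in> QF0 n"
  by (auto simp: QF0_iff intro: degree_add_less)

lemma QF0_zero: "n \<ge> 1 \<Longrightarrow> 0 \<in> QF0 n"
  by (simp add: QF0_iff)

lemma mod_mem_QF0: "n \<ge> 1 \<Longrightarrow> Y dvd p \<Longrightarrow> p mod modulus n \<in> QF0 n"
  by (simp add: QF0_iff degree_mod_modulus dvd_mod Y_dvd_modulus)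

lemma xm1_mem_QF0: "n \<ge> 1 \<Longrightarrow> xm1 n \<in> QF0 n"
  unfolding xm1_Y by (rule mod_mem_QF0) simp_all

lemma one_mem_F0: "n \<ge> 1 \<Longrightarrow> 1 \<in> F0 n"
  by (simp add: F0_iff QF0_zero)

lemma F0_add3: "n \<ge> 1 \<Longrightarrow> f \<in> F0 n \<Longrightarrow> g \<in> F0 n \<Longrightarrow> h \<in> F0 n \<Longrightarrow> f + g + h \<in> F0 n"
  using QF0_add[of n "1 + f" "1 + g"] QF0_add[of n "(1 + f) + (1 + g)" "1 + h"]
  by (simp add: F0_iff algebra_simps)

lemma qmult_mem_QF0: "n \<ge> 1 \<Longrightarrow> p \<in> QF0 n \<Longrightarrow> qmult n p q \<in> QF0 n"
  unfolding qmult_def by (rule mod_mem_QF0) (auto simp: QF0_iff)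

text \<open>Carries the product of \<open>F0 n\<close> over to \<open>QF0 n\<close> as the circle
  operation; the linear part is already reduced.\<close>

lemma qmult_one_plus:
  assumes "n \<ge> 1" "p \<in> QF0 n" "q \<in> QF0 n"
  shows "qmult n (1 + p) (1 + q) = 1 + (p + q + qmult n p q)"
proof -
  have "(1 + p) * (1 + q) = (1 + (p + q)) + p * q"
    by (simp add: algebra_simps)
  then have "qmult n (1 + p) (1 + q) = (1 + (p + q)) mod modulus n + qmult n p q"
    by (simp only: qmult_def poly_mod_add_left)
  moreover have "(1 + (p + q)) mod modulus n = 1 + (p + q)"
    using assms QF0_add[of n p q]
    by (intro mod_modulus_id degree_add_less) (auto simp: QF0_iff)
  ultimately show ?thesis
    by (simp only: add.assoc)
qed

lemma qmult_mem_F0: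
  assumes "n \<ge> 1" "f \<in> F0 n" "g \<in> F0 n"
  shows "qmult n f g \<in> F0 n"
  using assms qmult_one_plus[of n "1 + f" "1 + g"]
    QF0_add[of n "(1 + f) + (1 + g)" "qmult n (1 + f) (1 + g)"] QF0_add[of n "1 + f" "1 + g"]
  by (simp add: F0_iff qmult_mem_QF0)

section \<open>Substitution for \<open>Y\<close> and its reduction modulo
  \<open>modulus n\<close>\<close>

text \<open>Substitution before reduction: for fixed \<open>P\<close> an exact ring homomorphism in
  \<open>Q\<close>.\<close>

definition subst_Y :: "bit poly \<Rightarrow> bit poly \<Rightarrow> bit poly" where
  "subst_Y P Q = pcompose (pcompose Q Y) P"

lemma qcomp_subst: "qcomp n Q P = subst_Y P Q mod modulus n"
  by (simp add: qcomp_def subst_Y_def Y_eq)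

lemma subst_Y_add: "subst_Y P (Q + R) = subst_Y P Q + subst_Y P R"
  by (simp add: subst_Y_def pcompose_add)

lemma subst_Y_mult: "subst_Y P (Q * R) = subst_Y P Q * subst_Y P R"
  by (simp add: subst_Y_def pcompose_mult)

lemma subst_Y_0 [simp]: "subst_Y P 0 = 0"
  by (simp add: subst_Y_def)

lemma subst_Y_1 [simp]: "subst_Y P 1 = 1"
  by (simp add: subst_Y_def pcompose_1)

lemma subst_Y_power: "subst_Y P (Q ^ k) = subst_Y P Q ^ k"
  by (induction k) (simp_all add: subst_Y_mult)

lemma subst_Y_Y [simp]: "subst_Y P Y = P"
  by (simp add: subst_Y_def Y_eq pcompose_pCons)

lemma subst_Y_self [simp]: "subst_Y Y Q = Q"
  by (simp add: subst_Y_def Y_eq pcompose_pCons flip: pcompose_assoc)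

lemma subst_Y_assoc: "subst_Y R (subst_Y P Q) = subst_Y (subst_Y R P) Q"
  by (simp add: subst_Y_def pcompose_assoc)

text \<open>The value at \<open>1\<close> is the constant term in the variable \<open>Y\<close>;
  substituting a \<open>P\<close> without constant term keeps it.\<close>

lemma poly_subst_Y: "poly P 1 = 0 \<Longrightarrow> poly (subst_Y P Q) 1 = poly Q 1"
  by (simp add: subst_Y_def poly_pcompose Y_eq)

lemma dvd_subst_Y:
  assumes "Y ^ k dvd Q" "D dvd P ^ k"
  shows "D dvd subst_Y P Q"
proof -
  obtain R where "Q = Y ^ k * R" using assms(1) by (rule dvdE)
  then have "subst_Y P Q = P ^ k * subst_Y P R"
    by (simp add: subst_Y_mult subst_Y_power)
  then show ?thesis using assms(2) by simp
qed

lemma subst_Y_cong_right: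
  assumes "D dvd P + P'"
  shows "D dvd subst_Y P Q + subst_Y P' Q"
proof -
  have "D dvd pcompose A P + pcompose A P'" for A
  proof (induction A)
    case (pCons a A)
    \<comment> \<open>Horner step: the two copies of \<open>a\<close> cancel, as do the two copies
      of \<open>P * pcompose A P'\<close> on the right.\<close>
    have "pcompose (pCons a A) P + pcompose (pCons a A) P'
        = P * (pcompose A P + pcompose A P') + (P + P') * pcompose A P' "
      by (simp add: pcompose_pCons algebra_simps)
    then show ?case using pCons assms by simp
  qed simp
  then show ?thesis by (simp add: subst_Y_def)
qed

lemma mod_modulus_eq_iff: "p mod modulus n = q mod modulus n \<longleftrightarrow> modulus n dvd p + q"
  by (simp add: mod_eq_dvd_iff)

lemma qcomp_mod_right: "qcomp n Q (P mod modulus n) = qcomp n Q P"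
  unfolding qcomp_subst mod_modulus_eq_iff
  by (rule subst_Y_cong_right) (simp flip: mod_modulus_eq_iff)

text \<open>Reducing \<open>Q\<close> changes it by a multiple of \<open>Y ^ n\<close>, which is
  sent to a multiple of \<open>P ^ n\<close>; as \<open>Y\<close> divides \<open>P\<close>, this
  vanishes modulo \<open>modulus n\<close>.\<close>

lemma qcomp_mod_left:
  assumes "Y dvd P"
  shows "qcomp n (Q mod modulus n) P = qcomp n Q P"
proof -
  have "Y ^ n dvd Q mod modulus n + Q"
    using mod_modulus_eq_iff[of "Q mod modulus n" n Q] by (simp add: modulus_Y)
  moreover have "modulus n dvd P ^ n"
    using assms by (simp add: modulus_Y dvd_power_same)
  ultimately have "modulus n dvd subst_Y P (Q mod modulus n + Q)"
    by (rule dvd_subst_Y)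
  then show ?thesis
    by (simp only: qcomp_subst mod_modulus_eq_iff subst_Y_add)
qed

lemma qcomp_mem_QF0:
  assumes "n \<ge> 1" "P \<in> QF0 n" "Q \<in> QF0 n"
  shows "qcomp n Q P \<in> QF0 n"
  unfolding qcomp_subst using assms
  by (intro mod_mem_QF0) (auto simp: QF0_iff Y_dvd_iff poly_subst_Y)

lemma qcomp_add: "qcomp n (Q + R) P = qcomp n Q P + qcomp n R P"
  by (simp add: qcomp_subst subst_Y_add poly_mod_add_left)

lemma qcomp_qmult:
  assumes "Y dvd P"
  shows "qcomp n (qmult n Q R) P = qmult n (qcomp n Q P) (qcomp n R P)"
  unfolding qmult_def qcomp_mod_left[OF assms]
  by (simp only: qcomp_subst subst_Y_mult mod_mult_eq)

lemma qcomp_assoc: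
  assumes "Y dvd R"
  shows "qcomp n (qcomp n Q P) R = qcomp n Q (qcomp n P R)"
proof -
  have "qcomp n (qcomp n Q P) R = qcomp n (subst_Y P Q) R"
    unfolding qcomp_subst[of n Q P] by (rule qcomp_mod_left[OF assms])
  also have "\<dots> = qcomp n Q (subst_Y R P)"
    by (simp add: qcomp_subst subst_Y_assoc)
  also have "\<dots> = qcomp n Q (qcomp n P R)"
    by (simp add: qcomp_subst[of n P R] qcomp_mod_right)
  finally show ?thesis .
qed

lemma qcomp_xm1_left:
  assumes "n \<ge> 1" "P \<in> QF0 n"
  shows "qcomp n (xm1 n) P = P"
  unfolding xm1_Y qcomp_mod_left[OF Y_dvd_of_QF0[OF assms(2)]]
  using assms by (simp add: QF0_iff qcomp_subst mod_modulus_id)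

lemma qcomp_xm1_right:
  assumes "n \<ge> 1" "Q \<in> QF0 n"
  shows "qcomp n Q (xm1 n) = Q"
  unfolding xm1_Y qcomp_mod_right
  using assms by (simp add: QF0_iff qcomp_subst mod_modulus_id)

lemma monoid_QF0:
  assumes "n \<ge> 1"
  shows "monoid (QF0_monoid n)"
  using assms
  by unfold_locales
    (auto simp: QF0_monoid_def qcomp_mem_QF0 xm1_mem_QF0 qcomp_xm1_left qcomp_xm1_right
      qcomp_assoc Y_dvd_of_QF0)

section \<open>Induced maps and the endomorphisms given by substitution\<close>

lemma Qmap_eq:
  assumes "n \<ge> 1" "\<Phi> \<in> unital_endos n" "q \<in> QF0 n"
  shows "Qmap n \<Phi> q = 1 + \<Phi> (1 + q)"
proof -
  have "(THE r. \<exists>f \<in> F0 n. \<exists>g \<in> F0 n. q = f + g \<and> r = \<Phi> f + \<Phi> g) = 1 + \<Phi> (1 + q)"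
  proof (rule the_equality)
    have "1 + q \<in> F0 n" "1 \<in> F0 n" "\<Phi> 1 = 1"
      using assms by (simp_all add: F0_iff QF0_zero unital_endos_def)
    then show "\<exists>f \<in> F0 n. \<exists>g \<in> F0 n. q = f + g \<and> 1 + \<Phi> (1 + q) = \<Phi> f + \<Phi> g"
      by (intro bexI[of _ 1] bexI[of _ "1 + q"]) simp_all
  next
    fix r assume "\<exists>f \<in> F0 n. \<exists>g \<in> F0 n. q = f + g \<and> r = \<Phi> f + \<Phi> g"
    then obtain f g where fg: "f \<in> F0 n" "g \<in> F0 n" "q = f + g" "r = \<Phi> f + \<Phi> g" by blast
    \<comment> \<open>Since \<open>1 + f + g\<close> is a ternary sum inside \<open>F0 n\<close>,
      the value \<open>\<Phi> f + \<Phi> g\<close> depends only on \<open>f + g\<close>.\<close>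
    have "\<Phi> (1 + f + g) = \<Phi> 1 + \<Phi> f + \<Phi> g" "\<Phi> 1 = 1"
      using assms fg one_mem_F0 unfolding unital_endos_def by blast+
    then show "r = 1 + \<Phi> (1 + q)" by (simp add: fg add.assoc)
  qed
  then show ?thesis using assms by (simp add: Qmap_def)
qed

text \<open>For \<open>f = 1 + q\<close> the argument \<open>1 + f\<close> is \<open>q\<close>. The
  restriction supplies the value \<open>undefined\<close> off \<open>F0 n\<close> that
  \<open>unital_endos\<close> demands.\<close>

definition subst_endo :: "nat \<Rightarrow> bit poly \<Rightarrow> bit poly \<Rightarrow> bit poly" where
  "subst_endo n P = (\<lambda>f \<in> F0 n. 1 + qcomp n (1 + f) P)"

lemma subst_endo_one_plus: "q \<in> QF0 n \<Longrightarrow> subst_endo n P (1 + q) = 1 + qcomp n q P"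
  by (simp add: subst_endo_def F0_iff)

lemma F0_cases:
  assumes "f \<in> F0 n"
  obtains p where "f = 1 + p" "p \<in> QF0 n"
  using assms by (metis F0_iff bit_poly_add_cancel)

lemma subst_endo_mem:
  assumes "n \<ge> 1" "P \<in> QF0 n"
  shows "subst_endo n P \<in> unital_endos n"
proof -
  have P: "Y dvd P" using assms by (simp add: QF0_iff)
  have "subst_endo n P \<in> F0 n \<rightarrow>\<^sub>E F0 n"
    using assms by (auto simp: subst_endo_def F0_iff qcomp_mem_QF0)
  moreover have "subst_endo n P (f + g + h) = subst_endo n P f + subst_endo n P g + subst_endo n P h"
    if "f \<in> F0 n" "g \<in> F0 n" "h \<in> F0 n" for f g h
  proof -
    \<comment> \<open>Three ones add up to one, so the shift by \<open>1\<close> respects ternary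
      sums.\<close>
    have "1 + (f + g + h) = (1 + f) + (1 + g) + (1 + h)" by (simp add: algebra_simps)
    then show ?thesis using that assms
      by (simp add: subst_endo_def F0_add3 qcomp_add)
  qed
  moreover have "subst_endo n P (qmult n f g) = qmult n (subst_endo n P f) (subst_endo n P g)"
    if f: "f \<in> F0 n" and g: "g \<in> F0 n" for f g
  proof -
    obtain p q where pq: "f = 1 + p" "p \<in> QF0 n" "g = 1 + q" "q \<in> QF0 n"
      using f g by (metis F0_cases)
    then show ?thesis using assms P
      by (simp add: qmult_one_plus subst_endo_one_plus QF0_add qmult_mem_QF0 qcomp_add
          qcomp_qmult qcomp_mem_QF0)
  qed
  moreover have "subst_endo n P 1 = 1"
    using subst_endo_one_plus[OF QF0_zero[OF assms(1)], of P] by (simp add: qcomp_subst)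
  ultimately show ?thesis by (simp add: unital_endos_def)
qed

lemma Qmap_subst_endo:
  assumes "n \<ge> 1" "P \<in> QF0 n"
  shows "Qmap n (subst_endo n P) (xm1 n) = P"
  using assms
  by (simp add: Qmap_eq subst_endo_mem xm1_mem_QF0 subst_endo_one_plus qcomp_xm1_left)

section \<open>Every unital endomorphism is a substitution\<close>

lemma Qmap_mem_QF0:
  assumes "n \<ge> 1" "\<Phi> \<in> unital_endos n" "q \<in> QF0 n"
  shows "Qmap n \<Phi> q \<in> QF0 n"
proof -
  have "\<Phi> (1 + q) \<in> F0 n"
    using assms by (auto simp: unital_endos_def F0_iff)
  then show ?thesis using assms by (simp add: Qmap_eq F0_iff)
qed

lemma Qmap_add:
  assumes "n \<ge> 1" "\<Phi> \<in> unital_endos n" "p \<in> QF0 n" "q \<in> QF0 n"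
  shows "Qmap n \<Phi> (p + q) = Qmap n \<Phi> p + Qmap n \<Phi> q"
proof -
  have "1 + p \<in> F0 n" "1 + q \<in> F0 n" "1 \<in> F0 n"
    using assms by (simp_all add: F0_iff QF0_zero)
  \<comment> \<open>The third summand \<open>1\<close> is needed because a sum of two elements of
    \<open>F0 n\<close> leaves \<open>F0 n\<close>.\<close>
  then have "\<Phi> ((1 + p) + (1 + q) + 1) = \<Phi> (1 + p) + \<Phi> (1 + q) + 1"
    using assms(2) unfolding unital_endos_def mem_Collect_eq by metis
  moreover have "(1 + p) + (1 + q) + 1 = 1 + (p + q)" by simp
  ultimately show ?thesis using assms by (simp add: Qmap_eq QF0_add algebra_simps)
qed

text \<open>Expand the image of \<open>(1 + p) * (1 + q)\<close> by the circle operation; additivity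
  cancels the linear terms and leaves the product.\<close>

lemma Qmap_qmult:
  assumes "n \<ge> 1" "\<Phi> \<in> unital_endos n" "p \<in> QF0 n" "q \<in> QF0 n"
  shows "Qmap n \<Phi> (qmult n p q) = qmult n (Qmap n \<Phi> p) (Qmap n \<Phi> q)"
proof -
  let ?\<psi> = "Qmap n \<Phi>"
  have \<Phi>: "\<Phi> (1 + r) = 1 + ?\<psi> r" if "r \<in> QF0 n" for r
    using that assms by (simp add: Qmap_eq)
  have "\<Phi> (qmult n (1 + p) (1 + q)) = qmult n (\<Phi> (1 + p)) (\<Phi> (1 + q))"
    using assms by (simp add: unital_endos_def F0_iff)
  then have "1 + ?\<psi> (p + q + qmult n p q) = 1 + (?\<psi> p + ?\<psi> q + qmult n (?\<psi> p) (?\<psi> q))"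
    using assms by (simp add: \<Phi> qmult_one_plus QF0_add qmult_mem_QF0 Qmap_mem_QF0)
  then show ?thesis
    using assms by (simp add: Qmap_add QF0_add qmult_mem_QF0)
qed

lemma Qmap_zero:
  assumes "n \<ge> 1" "\<Phi> \<in> unital_endos n"
  shows "Qmap n \<Phi> 0 = 0"
  using Qmap_add[OF assms QF0_zero QF0_zero] assms by simp

text \<open>
  A multiple of \<open>Y\<close> has the form \<open>c * Y + Y * q\<close> with \<open>c\<close> a constant and \<open>q\<close> a multiple of \<open>Y\<close>
  of smaller degree, so the non-unital ring \<open>QF0 n\<close> is generated by \<open>Y\<close>.
\<close>

lemma Qmap_mod:
  assumes "n \<ge> 1" "\<Phi> \<in> unital_endos n" "Y dvd p"
  shows "Qmap n \<Phi> (p mod modulus n) = qcomp n p (Qmap n \<Phi> (xm1 n))"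
  using assms(3)
proof (induction "degree p" arbitrary: p rule: less_induct)
  case less
  let ?\<psi> = "Qmap n \<Phi>"
  let ?P = "?\<psi> (xm1 n)"
  show ?case
  proof (cases "p = 0")
    case True
    then show ?thesis using assms by (simp add: Qmap_zero qcomp_subst)
  next
    case False
    obtain r where r: "p = Y * r" using less.prems by (rule dvdE)
    \<comment> \<open>Adding the value of \<open>r\<close> at \<open>1\<close> makes
      \<open>r\<close> divisible by \<open>Y\<close>, so the induction hypothesis applies to
      \<open>q\<close>.\<close>
    define c where "c = poly r 1"
    define q where "q = r + [:c:]"
    have "r \<noteq> 0" using False r by auto
    then have deg_p: "degree p = Suc (degree r)" by (simp add: r degree_mult_eq)
    have q: "Y dvd q"
      by (simp add: q_def c_def Y_dvd_iff)
    have "degree q \<le> degree r"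
      unfolding q_def by (rule degree_add_le) simp_all
    then have IH: "?\<psi> (q mod modulus n) = qcomp n q ?P"
      using less.hyps[of q] q deg_p by simp
    have r_eq: "r = [:c:] + q"
      by (simp add: q_def algebra_simps)
    have p_eq: "p = [:c:] * Y + Y * q"
      by (simp add: r r_eq algebra_simps)
    \<comment> \<open>A scalar in F_2 is \<open>0\<close> or \<open>1\<close>, so no linearity over
      scalars is required.\<close>
    have c: "?\<psi> ([:c:] * Y mod modulus n) = qcomp n ([:c:] * Y) ?P"
    proof (cases "c = 0")
      case True
      then show ?thesis using assms by (simp add: Qmap_zero qcomp_subst)
    next
      case False
      then have "[:c:] * Y = Y" by simp
      moreover have "qcomp n Y ?P = ?P"
        using Qmap_mem_QF0[OF assms(1,2) xm1_mem_QF0] assms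
        by (simp add: qcomp_subst QF0_iff mod_modulus_id)
      ultimately show ?thesis by (simp add: xm1_Y)
    qed
    \<comment> \<open>Each summand and factor is reduced separately, so that additivity and
      multiplicativity on \<open>QF0 n\<close> apply.\<close>
    have "p mod modulus n = [:c:] * Y mod modulus n + qmult n (xm1 n) (q mod modulus n)"
      unfolding p_eq poly_mod_add_left by (simp add: qmult_def xm1_Y mod_mult_eq)
    also have "?\<psi> \<dots> = qcomp n ([:c:] * Y) ?P + qmult n ?P (qcomp n q ?P)"
      using assms q mod_mem_QF0[of n "[:c:] * Y"]
      by (simp only: Qmap_add Qmap_qmult mod_mem_QF0 xm1_mem_QF0 qmult_mem_QF0 c IH dvd_triv_right)
    also have "qmult n ?P (qcomp n q ?P) = qcomp n (Y * q) ?P"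
      by (simp add: qmult_def qcomp_subst subst_Y_mult mod_mult_right_eq)
    also have "qcomp n ([:c:] * Y) ?P + qcomp n (Y * q) ?P = qcomp n p ?P"
      by (simp only: p_eq qcomp_add)
    finally show ?thesis .
  qed
qed

lemma Qmap_qcomp:
  assumes "n \<ge> 1" "\<Phi> \<in> unital_endos n" "q \<in> QF0 n"
  shows "Qmap n \<Phi> q = qcomp n q (Qmap n \<Phi> (xm1 n))"
  using Qmap_mod[of n \<Phi> q] assms by (simp add: QF0_iff mod_modulus_id)

lemma endo_eq_subst_endo:
  assumes "n \<ge> 1" "\<Phi> \<in> unital_endos n"
  shows "\<Phi> = subst_endo n (Qmap n \<Phi> (xm1 n))"
proof
  fix f
  show "\<Phi> f = subst_endo n (Qmap n \<Phi> (xm1 n)) f"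
  proof (cases "f \<in> F0 n")
    case True
    then obtain p where "f = 1 + p" "p \<in> QF0 n" by (rule F0_cases)
    then show ?thesis
      using assms Qmap_qcomp[of n \<Phi> p]
      by (simp add: subst_endo_one_plus Qmap_eq[of n \<Phi> p] bit_poly_add_eq_iff)
  next
    \<comment> \<open>Off \<open>F0 n\<close> both maps are \<open>undefined\<close>.\<close>
    case False
    then show ?thesis
      using assms by (auto simp: subst_endo_def unital_endos_def)
  qed
qed

section \<open>Composition of endomorphisms and the isomorphism of monoids\<close>

lemma compose_mem_unital_endos:
  assumes "n \<ge> 1" "\<Phi> \<in> unital_endos n" "\<Psi> \<in> unital_endos n"
  shows "compose (F0 n) \<Phi> \<Psi> \<in> unital_endos n"
proof -
  have "\<Psi> f \<in> F0 n" "\<Phi> f \<in> F0 n" if "f \<in> F0 n" for f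
    using assms that by (auto simp: unital_endos_def)
  then show ?thesis
    using assms
    by (auto simp: unital_endos_def compose_def F0_add3 qmult_mem_F0 one_mem_F0)
qed

text \<open>The outer map acts on the polynomial \<open>Qmap n \<Psi> (xm1 n)\<close> by
  substituting its own value at \<open>xm1 n\<close>, hence the reversed order.\<close>

lemma Qmap_compose:
  assumes "n \<ge> 1" "\<Phi> \<in> unital_endos n" "\<Psi> \<in> unital_endos n"
  shows "Qmap n (compose (F0 n) \<Phi> \<Psi>) (xm1 n) = qcomp n (Qmap n \<Psi> (xm1 n)) (Qmap n \<Phi> (xm1 n))"
proof -
  have "Qmap n (compose (F0 n) \<Phi> \<Psi>) (xm1 n) = Qmap n \<Phi> (Qmap n \<Psi> (xm1 n))"
    using assms Qmap_mem_QF0[of n \<Psi> "xm1 n"]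
    by (simp add: Qmap_eq compose_mem_unital_endos xm1_mem_QF0 compose_eq F0_iff)
  then show ?thesis
    using assms by (metis Qmap_qcomp Qmap_mem_QF0 xm1_mem_QF0)
qed

lemma monoid_endo:
  assumes "n \<ge> 1"
  shows "monoid (endo_monoid n)"
proof -
  have ext: "\<Phi> \<in> F0 n \<rightarrow>\<^sub>E F0 n" if "\<Phi> \<in> unital_endos n" for \<Phi>
    using that by (simp add: unital_endos_def)
  have "(\<lambda>f \<in> F0 n. f) \<in> unital_endos n"
    using assms by (auto simp: unital_endos_def F0_add3 qmult_mem_F0 one_mem_F0)
  moreover have "compose (F0 n) (compose (F0 n) \<Phi> \<Psi>) \<Theta> = compose (F0 n) \<Phi> (compose (F0 n) \<Psi> \<Theta>)"
    if "\<Theta> \<in> unital_endos n" for \<Phi> \<Psi> \<Theta>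
    using ext[OF that] by (intro compose_assoc[symmetric]) auto
  moreover have "compose (F0 n) (\<lambda>f \<in> F0 n. f) \<Phi> = \<Phi>" "compose (F0 n) \<Phi> (\<lambda>f \<in> F0 n. f) = \<Phi>"
    if "\<Phi> \<in> unital_endos n" for \<Phi>
    using ext[OF that] by (auto intro!: Id_compose compose_Id simp: PiE_def)
  ultimately show ?thesis
    using assms
    by unfold_locales (simp_all add: endo_monoid_def compose_mem_unital_endos)
qed

lemma Qmap_iso:
  assumes "n \<ge> 1"
  shows "(\<lambda>\<Phi>. Qmap n \<Phi> (xm1 n)) \<in> iso (endo_monoid n) (opposite_monoid (QF0_monoid n))"
proof -
  have "bij_betw (\<lambda>\<Phi>. Qmap n \<Phi> (xm1 n)) (unital_endos n) (QF0 n)"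
    \<comment> \<open>The inverse sends a polynomial to substitution of it.\<close>
    by (rule bij_betw_byWitness[of _ "subst_endo n"])
      (use assms in \<open>auto simp: Qmap_subst_endo subst_endo_mem Qmap_mem_QF0 xm1_mem_QF0
        simp flip: endo_eq_subst_endo\<close>)
  then show ?thesis
    using assms
    by (auto simp: iso_def hom_def endo_monoid_def opposite_monoid_def QF0_monoid_def
        Qmap_compose Qmap_mem_QF0 xm1_mem_QF0)
qed

section \<open>Automorphisms and invertibility under substitution\<close>

text \<open>Translation by \<open>1\<close> is a bijection between \<open>QF0 n\<close> and
  \<open>F0 n\<close> and conjugates one map into the other.\<close>

lemma bij_subst_endo_iff:
  assumes "n \<ge> 1"
  shows "bij_betw (subst_endo n P) (F0 n) (F0 n) \<longleftrightarrow> bij_betw (\<lambda>q. qcomp n q P) (QF0 n) (QF0 n)"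
proof -
  have F0: "bij_betw ((+) 1) (QF0 n) (F0 n)" "bij_betw ((+) 1) (F0 n) (QF0 n)"
    by (rule bij_betw_byWitness[of _ "(+) 1"]; auto simp: F0_iff)+
  have "bij_betw (subst_endo n P) (F0 n) (F0 n)
      \<longleftrightarrow> bij_betw (subst_endo n P \<circ> (+) 1) (QF0 n) (F0 n)"
    by (rule bij_betw_comp_iff[OF F0(1)])
  also have "\<dots> \<longleftrightarrow> bij_betw ((+) 1 \<circ> (\<lambda>q. qcomp n q P)) (QF0 n) (F0 n)"
    by (rule bij_betw_cong) (simp add: subst_endo_one_plus)
  also have "\<dots> \<longleftrightarrow> bij_betw (\<lambda>q. qcomp n q P) (QF0 n) (QF0 n)"
  proof
    assume "bij_betw ((+) 1 \<circ> (\<lambda>q. qcomp n q P)) (QF0 n) (F0 n)"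
    from bij_betw_trans[OF this F0(2)]
    show "bij_betw (\<lambda>q. qcomp n q P) (QF0 n) (QF0 n)" by (simp add: comp_def)
  next
    assume "bij_betw (\<lambda>q. qcomp n q P) (QF0 n) (QF0 n)"
    then show "bij_betw ((+) 1 \<circ> (\<lambda>q. qcomp n q P)) (QF0 n) (F0 n)"
      using F0(1) by (rule bij_betw_trans)
  qed
  finally show ?thesis .
qed

lemma bij_qcomp_iff_invertible:
  assumes "n \<ge> 1" "P \<in> QF0 n"
  shows "bij_betw (\<lambda>q. qcomp n q P) (QF0 n) (QF0 n) \<longleftrightarrow>
    (\<exists>Q \<in> QF0 n. qcomp n P Q = xm1 n \<and> qcomp n Q P = xm1 n)"
proof
  assume bij: "bij_betw (\<lambda>q. qcomp n q P) (QF0 n) (QF0 n)"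
  then obtain Q where Q: "Q \<in> QF0 n" "qcomp n Q P = xm1 n"
    using xm1_mem_QF0[OF assms(1)] by (metis bij_betw_def imageE)
  \<comment> \<open>The preimage \<open>Q\<close> of \<open>xm1 n\<close> is a one-sided inverse.
    Both \<open>qcomp n P Q\<close> and \<open>xm1 n\<close> are sent to \<open>P\<close>, so
    injectivity makes it two-sided.\<close>
  have "qcomp n (qcomp n P Q) P = qcomp n (xm1 n) P"
    using assms Q by (simp add: qcomp_assoc QF0_iff[THEN iffD1] qcomp_xm1_left qcomp_xm1_right)
  then have "qcomp n P Q = xm1 n"
    using bij assms Q by (meson bij_betw_def inj_onD qcomp_mem_QF0 xm1_mem_QF0)
  with Q show "\<exists>Q \<in> QF0 n. qcomp n P Q = xm1 n \<and> qcomp n Q P = xm1 n" by blast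
next
  assume "\<exists>Q \<in> QF0 n. qcomp n P Q = xm1 n \<and> qcomp n Q P = xm1 n"
  then obtain Q where Q: "Q \<in> QF0 n" "qcomp n P Q = xm1 n" "qcomp n Q P = xm1 n" by blast
  have "Y dvd P" "Y dvd Q" using assms Q by (simp_all add: QF0_iff)
  then show "bij_betw (\<lambda>q. qcomp n q P) (QF0 n) (QF0 n)"
    using assms Q
    by (intro bij_betw_byWitness[of _ "\<lambda>q. qcomp n q Q"])
      (auto simp: qcomp_assoc qcomp_xm1_right qcomp_mem_QF0)
qed

section \<open>The \<open>Y\<close>-adic order and the linear coefficient\<close>

text \<open>Here \<open>P\<close> is \<open>Y\<close> times a factor \<open>v\<close> not vanishing
  at \<open>1\<close>, so substitution creates no extra factors of \<open>Y\<close>; they are peeled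
  off \<open>R\<close> one at a time.\<close>

lemma power_dvd_of_subst_Y:
  assumes "Y dvd P" "\<not> Y\<^sup>2 dvd P" "Y ^ n dvd subst_Y P R"
  shows "Y ^ n dvd R"
proof -
  obtain v where v: "P = Y * v" using assms(1) by blast
  have v1: "poly v 1 \<noteq> 0"
    using assms(2) by (auto simp: v power2_eq_square simp flip: Y_dvd_iff)
  have "Y ^ j dvd R" if "j \<le> n" for j
    using that
  proof (induction j)
    case (Suc j)
    then obtain u where u: "R = Y ^ j * u" by auto
    have "Y ^ Suc j dvd subst_Y P R"
      using Suc.prems assms(3) by (meson dvd_trans le_imp_power_dvd)
    also have "subst_Y P R = Y ^ j * (v ^ j * subst_Y P u)"
      by (simp add: u subst_Y_mult subst_Y_power v power_mult_distrib algebra_simps)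
    \<comment> \<open>After cancelling \<open>Y ^ j\<close>, evaluation at \<open>1\<close> decides:
      \<open>v\<close> is nonzero there and substitution keeps the value of
      \<open>u\<close>.\<close>
    finally have "Y dvd v ^ j * subst_Y P u"
      by (simp add: mult.commute[of Y])
    then have "poly u 1 = 0"
      using v1 assms(1) by (simp add: Y_dvd_iff poly_subst_Y)
    then show ?case by (simp add: u mult.commute[of Y] flip: Y_dvd_iff)
  qed simp
  then show ?thesis by simp
qed

text \<open>The bound \<open>n \<ge> 2\<close> matters: for \<open>n = 1\<close> the only
  \<open>P\<close> is \<open>0\<close>, which \<open>Y ^ 2\<close> divides, yet the map on
  \<open>{0}\<close> is bijective.\<close>

lemma bij_qcomp_iff_order:
  assumes "n \<ge> 2" "P \<in> QF0 n"
  shows "bij_betw (\<lambda>q. qcomp n q P) (QF0 n) (QF0 n) \<longleftrightarrow> \<not> Y\<^sup>2 dvd P"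
proof
  have n: "n \<ge> 1" using assms by simp
  assume "bij_betw (\<lambda>q. qcomp n q P) (QF0 n) (QF0 n)"
  then obtain Q where Q: "Q \<in> QF0 n" "xm1 n = qcomp n Q P"
    using xm1_mem_QF0[OF n] by (metis bij_betw_def imageE)
  show "\<not> Y\<^sup>2 dvd P"
  proof
    assume "Y\<^sup>2 dvd P"
    then have "Y\<^sup>2 dvd subst_Y P Q"
      using Q n by (intro dvd_subst_Y[of 1]) (simp_all add: QF0_iff)
    moreover have "Y\<^sup>2 dvd modulus n"
      using assms by (simp add: modulus_Y le_imp_power_dvd)
    ultimately have "Y\<^sup>2 dvd xm1 n"
      unfolding Q(2) qcomp_subst by (rule dvd_mod)
    then have "Y\<^sup>2 dvd Y"
      using assms by (simp add: xm1_Y mod_modulus_id)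
    then show False
      using dvd_imp_degree_le[of "Y\<^sup>2" Y] by (simp add: degree_power_eq)
  qed
next
  have n: "n \<ge> 1" and P: "Y dvd P" using assms by (simp_all add: QF0_iff)
  assume ord: "\<not> Y\<^sup>2 dvd P"
  have "inj_on (\<lambda>q. qcomp n q P) (QF0 n)"
  proof (rule inj_onI)
    fix q r assume q: "q \<in> QF0 n" and r: "r \<in> QF0 n" and "qcomp n q P = qcomp n r P"
    \<comment> \<open>By additivity, equal images put \<open>q + r\<close> in the kernel; being of
      degree below \<open>n\<close> and divisible by \<open>Y ^ n\<close>, it is zero.\<close>
    then have "Y ^ n dvd subst_Y P (q + r)"
      unfolding qcomp_subst mod_modulus_eq_iff by (simp add: subst_Y_add modulus_Y)
    then have "modulus n dvd q + r"
      using power_dvd_of_subst_Y P ord by (simp add: modulus_Y)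
    then show "q = r"
      using q r n by (simp add: QF0_iff mod_modulus_id flip: mod_modulus_eq_iff)
  qed
  moreover have "(\<lambda>q. qcomp n q P) ` QF0 n \<subseteq> QF0 n"
    using assms n by (auto simp: qcomp_mem_QF0)
  ultimately show "bij_betw (\<lambda>q. qcomp n q P) (QF0 n) (QF0 n)"
    by (simp add: bij_betw_def endo_inj_surj finite_QF0)
qed

text \<open>Terms from index 2 on are divisible by \<open>Y ^ 2\<close>, so the linear coefficient
  decides, and over F_2 nonzero means \<open>1\<close>.\<close>

lemma order_one_iff:
  assumes "n \<ge> 2" "P \<in> QF0 n"
  shows "\<not> Y\<^sup>2 dvd P \<longleftrightarrow> (\<exists>\<epsilon>. P = Y + (\<Sum>k = 2..n - 1. smult (\<epsilon> k) (Y ^ k)))"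
proof -
  have dvd: "Y\<^sup>2 dvd (\<Sum>k = 2..n - 1. smult (\<epsilon> k) (Y ^ k))" for \<epsilon>
    using assms by (intro Y_power_sum) simp_all
  obtain \<epsilon> where "P = (\<Sum>k = 1..n - 1. smult (\<epsilon> k) (Y ^ k))"
    using assms(2) unfolding QF0_def Y_def[symmetric] by blast
  also have "{1..n - 1} = insert 1 {2..n - 1}" using assms by auto
  finally have P: "P = smult (\<epsilon> 1) Y + (\<Sum>k = 2..n - 1. smult (\<epsilon> k) (Y ^ k))" by simp
  show ?thesis
  proof
    assume "\<not> Y\<^sup>2 dvd P"
    then have "\<epsilon> 1 = 1" using P dvd by (cases "\<epsilon> 1 = 0") simp_all
    then show "\<exists>\<epsilon>. P = Y + (\<Sum>k = 2..n - 1. smult (\<epsilon> k) (Y ^ k))" using P by auto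
  next
    assume "\<exists>\<epsilon>. P = Y + (\<Sum>k = 2..n - 1. smult (\<epsilon> k) (Y ^ k))"
    moreover have "\<not> Y\<^sup>2 dvd Y"
      using dvd_imp_degree_le[of "Y\<^sup>2" Y] by (auto simp: degree_power_eq)
    ultimately show "\<not> Y\<^sup>2 dvd P" using dvd by (auto simp: dvd_add_left_iff)
  qed
qed

lemma bij_qcomp_iff:
  assumes "n \<ge> 1" "P \<in> QF0 n"
  shows "bij_betw (\<lambda>q. qcomp n q P) (QF0 n) (QF0 n) \<longleftrightarrow>
    (\<exists>\<epsilon>. P = xm1 n + (\<Sum>k = 2..n - 1. smult (\<epsilon> k) (Y ^ k)))"
proof (cases "n \<ge> 2")
  case True
  then show ?thesis
    using assms by (simp add: bij_qcomp_iff_order order_one_iff xm1_Y mod_modulus_id)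
next
  case False
  \<comment> \<open>Here \<open>QF0 n\<close> is \<open>{0}\<close>, \<open>xm1 n\<close> is
    \<open>0\<close> and the sum is empty, so both sides hold.\<close>
  then have n: "n = 1" using assms by simp
  then have "QF0 n = {0}" by (simp add: QF0_def)
  moreover have "xm1 n = 0" by (simp add: n xm1_Y modulus_Y)
  ultimately show ?thesis
    using assms n by (simp add: bij_betw_def qcomp_subst)
qed

theorem theorem3p19:
  fixes n :: nat
  assumes "n \<ge> 1"
  shows "monoid (endo_monoid n) \<and> monoid (QF0_monoid n) \<and>
    (\<lambda>\<Phi>. Qmap n \<Phi> (xm1 n)) \<in> iso (endo_monoid n) (opposite_monoid (QF0_monoid n)) \<and>
    (\<forall>P\<^sub>0 \<Phi>. 1 + P\<^sub>0 \<in> F0 n \<and> \<Phi> \<in> unital_endos n \<and> Qmap n \<Phi> (xm1 n) = P\<^sub>0 \<longrightarrow>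
      (\<Phi> \<in> unital_autos n \<longleftrightarrow>
        (\<exists>Q\<^sub>0. 1 + Q\<^sub>0 \<in> F0 n \<and> qcomp n P\<^sub>0 Q\<^sub>0 = xm1 n \<and> qcomp n Q\<^sub>0 P\<^sub>0 = xm1 n)) \<and>
      ((\<exists>Q\<^sub>0. 1 + Q\<^sub>0 \<in> F0 n \<and> qcomp n P\<^sub>0 Q\<^sub>0 = xm1 n \<and> qcomp n Q\<^sub>0 P\<^sub>0 = xm1 n) \<longleftrightarrow>
        (\<exists>\<epsilon> :: nat \<Rightarrow> bit.
          Qmap n \<Phi> (xm1 n) = xm1 n + (\<Sum>k = 2..n - 1. smult (\<epsilon> k) ([:-1, 1:] ^ k)))))"
proof -
  have "(\<Phi> \<in> unital_autos n \<longleftrightarrow>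
        (\<exists>Q\<^sub>0. 1 + Q\<^sub>0 \<in> F0 n \<and> qcomp n P\<^sub>0 Q\<^sub>0 = xm1 n \<and> qcomp n Q\<^sub>0 P\<^sub>0 = xm1 n)) \<and>
      ((\<exists>Q\<^sub>0. 1 + Q\<^sub>0 \<in> F0 n \<and> qcomp n P\<^sub>0 Q\<^sub>0 = xm1 n \<and> qcomp n Q\<^sub>0 P\<^sub>0 = xm1 n) \<longleftrightarrow>
        (\<exists>\<epsilon>. Qmap n \<Phi> (xm1 n) = xm1 n + (\<Sum>k = 2..n - 1. smult (\<epsilon> k) ([:-1, 1:] ^ k))))"
    if "\<Phi> \<in> unital_endos n" and P: "Qmap n \<Phi> (xm1 n) = P\<^sub>0" for P\<^sub>0 \<Phi>
  proof -
    have P0: "P\<^sub>0 \<in> QF0 n"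
      using that assms Qmap_mem_QF0 xm1_mem_QF0 by blast
    \<comment> \<open>Once \<Phi> is a substitution, all three conditions reduce to bijectivity of
      \<open>\<lambda>q. qcomp n q P\<^sub>0\<close> on \<open>QF0 n\<close>.\<close>
    have "\<Phi> = subst_endo n P\<^sub>0"
      using that assms endo_eq_subst_endo by blast
    then have "\<Phi> \<in> unital_autos n \<longleftrightarrow> bij_betw (\<lambda>q. qcomp n q P\<^sub>0) (QF0 n) (QF0 n)"
      using that assms by (simp add: unital_autos_def bij_subst_endo_iff)
    moreover have "(\<exists>Q\<^sub>0. 1 + Q\<^sub>0 \<in> F0 n \<and> qcomp n P\<^sub>0 Q\<^sub>0 = xm1 n \<and> qcomp n Q\<^sub>0 P\<^sub>0 = xm1 n)
        \<longleftrightarrow> bij_betw (\<lambda>q. qcomp n q P\<^sub>0) (QF0 n) (QF0 n)"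
      using bij_qcomp_iff_invertible[OF assms P0] by (auto simp: F0_iff)
    ultimately show ?thesis
      using bij_qcomp_iff[OF assms P0] unfolding P Y_def by blast
  qed
  then show ?thesis
    using monoid_endo[OF assms] monoid_QF0[OF assms] Qmap_iso[OF assms] by blast
qed

end
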